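(* Let $\mathcal{H}$ be a separable Hilbert space, let $I$ be a countable index set, and let $\{f_i\}_{i\in I}$ be a unit norm Bessel sequence in $\mathcal{H}$ which is finitely linearly independent. Then $\{f_i\}_{i\in I}$ is a union of two sets each of which is $\omega$-independent for $\ell_2$-sequences; that is, there is a partition $I=I_1\cup I_2$ such that for each $j=1,2$ the family $\{f_i\}_{i\in I_j}$ is $\omega$-independent for $\ell_2$-sequences.
   Context: A family $\{f_i\}_{i\in I}$ in $\mathcal{H}$ is a Bessel sequence if there is $B<\infty$ with $\sum_{i\in I}|\langle g,f_i\rangle|^2\le B\|g\|^2$ for all $g\in\mathcal{H}$; it is unit norm if $\|f_i\|=1$ for all $i\in I$. It is finitely linearly independent if every finite subfamily is linearly independent. A family $\{f_i\}_{i\in J}$ is $\omega$-independent for $\ell_2$-sequences if, whenever $c=(c_i)_{i\in J}$ is a square-summable family of scalars with $\sum_{i\in J}c_if_i=0$, it follows that $c=0$. (For a Bessel sequence and square-summable $c$, the sum converges unconditionally in norm.) Countable means finite or infinite countable, and the sets of a partition are allowed to be empty. *)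

theory Defs
  imports "HOL-Analysis.Analysis"
begin

text \<open>Complex inner product spaces, in parallel to the library class \<open>real_inner\<close>.
  The inner product is linear in its first argument.  Since \<open>scaleC\<close> extends the scalar
  multiplication \<open>scaleR\<close>, the law \<open>scaleC 1 x = x\<close> follows; positive definiteness follows
  from the fact that \<open>cinner\<close> induces the norm.  A real resp. complex Hilbert space is a type of
  class \<open>{real_inner, complete_space}\<close> resp. \<open>{complex_inner, complete_space}\<close>.\<close>

class complex_inner = real_normed_vector +
  fixes scaleC :: "complex \<Rightarrow> 'a \<Rightarrow> 'a"
    and cinner :: "'a \<Rightarrow> 'a \<Rightarrow> complex"
  assumes scaleC_add_right: "scaleC c (x + y) = scaleC c x + scaleC c y"
    and scaleC_add_left: "scaleC (c + d) x = scaleC c x + scaleC d x"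
    and scaleC_scaleC: "scaleC c (scaleC d x) = scaleC (c * d) x"
    and scaleC_of_real: "scaleC (complex_of_real r) x = r *\<^sub>R x"
    and cinner_commute: "cinner x y = cnj (cinner y x)"
    and cinner_add_left: "cinner (x + y) z = cinner x z + cinner y z"
    and cinner_scaleC_left: "cinner (scaleC c x) y = c * cinner x y"
    and cinner_self: "cinner x x = complex_of_real ((norm x)\<^sup>2)"

instantiation complex :: complex_inner
begin

definition scaleC_complex :: "complex \<Rightarrow> complex \<Rightarrow> complex"
  where "scaleC_complex c x = c * x"

definition cinner_complex :: "complex \<Rightarrow> complex \<Rightarrow> complex"
  where "cinner_complex x y = x * cnj y"

instance
proof
  fix x :: complex
  show "cinner x x = complex_of_real ((norm x)\<^sup>2)"
    unfolding cinner_complex_def by (rule complex_norm_square [symmetric])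
qed (simp_all add: scaleC_complex_def cinner_complex_def algebra_simps scaleR_conv_of_real)

end

text \<open>The following notions are parametrised by the inner product \<open>ip\<close> or the scalar
  multiplication \<open>sc\<close>, so that they cover real scalars (\<open>inner\<close>, \<open>scaleR\<close>) and complex
  scalars (\<open>cinner\<close>, \<open>scaleC\<close>).  The summability clause in \<open>bessel_sequence\<close> is needed
  because \<open>infsum\<close> is \<open>0\<close> for families that are not summable.\<close>

definition bessel_sequence ::
    "('h \<Rightarrow> 'h \<Rightarrow> 'k::real_normed_vector) \<Rightarrow> 'i set \<Rightarrow> ('i \<Rightarrow> 'h::real_normed_vector) \<Rightarrow> bool"
  where "bessel_sequence ip I f \<longleftrightarrow>
    (\<exists>B::real. \<forall>g.
      (\<lambda>i. (norm (ip g (f i)))\<^sup>2) summable_on I \<and>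
      (\<Sum>\<^sub>\<infinity>i\<in>I. (norm (ip g (f i)))\<^sup>2) \<le> B * (norm g)\<^sup>2)"

definition unit_norm :: "'i set \<Rightarrow> ('i \<Rightarrow> 'h::real_normed_vector) \<Rightarrow> bool"
  where "unit_norm I f \<longleftrightarrow> (\<forall>i\<in>I. norm (f i) = 1)"

text \<open>Linear independence is that of a family, not of its range: a repeated vector makes the
  family dependent.\<close>

definition finitely_independent ::
    "('k::real_normed_vector \<Rightarrow> 'h \<Rightarrow> 'h) \<Rightarrow> 'i set \<Rightarrow> ('i \<Rightarrow> 'h::real_normed_vector) \<Rightarrow> bool"
  where "finitely_independent sc I f \<longleftrightarrow>
    (\<forall>F. finite F \<and> F \<subseteq> I \<longrightarrow>
      (\<forall>c :: 'i \<Rightarrow> 'k. (\<Sum>i\<in>F. sc (c i) (f i)) = 0 \<longrightarrow> (\<forall>i\<in>F. c i = 0)))"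

definition omega_independent_l2 ::
    "('k::real_normed_vector \<Rightarrow> 'h \<Rightarrow> 'h) \<Rightarrow> 'i set \<Rightarrow> ('i \<Rightarrow> 'h::real_normed_vector) \<Rightarrow> bool"
  where "omega_independent_l2 sc J f \<longleftrightarrow>
    (\<forall>c :: 'i \<Rightarrow> 'k.
      (\<lambda>i. (norm (c i))\<^sup>2) summable_on J \<and> ((\<lambda>i. sc (c i) (f i)) has_sum 0) J \<longrightarrow>
      (\<forall>i\<in>J. c i = 0))"

end

theory Submission
  imports Defs
begin

text \<open>Orthogonalising \<open>f i\<close> against the other members of a finite set \<open>F\<close> yields a vector
  \<open>y\<close> whose coefficients \<open>\<phi> j = \<langle>f j, y\<rangle>\<close> vanish on \<open>F - {i}\<close> but not at \<open>i\<close>, and are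
  square-summable by the Bessel condition.  Hence there are finite sets \<open>F 0 \<subseteq> F 1 \<subseteq> \<dots>\<close>
  exhausting \<open>I\<close> such that the coefficients belonging to \<open>F k\<close> have small \<open>\<ell>\<^sub>2\<close>-mass off
  \<open>F (k + 1)\<close>.  If \<open>J\<close> misses the layer \<open>F (k + 1) - F k\<close>, then pairing a relation
  \<open>(\<Sum>j\<in>J. c j f j) = 0\<close> with \<open>y\<close> leaves \<open>c i \<phi> i\<close> plus a tail that is small by
  Cauchy-Schwarz; so \<open>c = 0\<close> if \<open>J\<close> misses infinitely many layers.  The layers of even and
  of odd index give the two parts.\<close>

section \<open>Finite tails of unconditional sums, and Cauchy-Schwarz for finite sums\<close>

lemma has_sum_dist_less:
  fixes \<psi> :: "'i \<Rightarrow> 'b::{metric_space, comm_monoid_add}"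
  assumes "(\<psi> has_sum s) I" and "e > 0"
  obtains S where "finite S" "S \<subseteq> I"
    "\<And>G. finite G \<Longrightarrow> S \<subseteq> G \<Longrightarrow> G \<subseteq> I \<Longrightarrow> dist (sum \<psi> G) s < e"
proof -
  have "\<forall>\<^sub>F S in finite_subsets_at_top I. dist (sum \<psi> S) s < e"
    using assms unfolding has_sum_def by (rule tendstoD)
  then have "\<exists>S. finite S \<and> S \<subseteq> I \<and>
      (\<forall>G. finite G \<and> S \<subseteq> G \<and> G \<subseteq> I \<longrightarrow> dist (sum \<psi> G) s < e)"
    unfolding eventually_finite_subsets_at_top .
  then show thesis
    using that by (elim exE conjE) simp
qed

lemma summable_on_small_tail:
  fixes \<psi> :: "'i \<Rightarrow> real"
  assumes "\<psi> summable_on I" and "e > 0"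
  obtains S where "finite S" "S \<subseteq> I"
    "\<And>G. finite G \<Longrightarrow> G \<subseteq> I - S \<Longrightarrow> sum \<psi> G \<le> e"
proof -
  obtain s where "(\<psi> has_sum s) I"
    using assms(1) by (auto simp: summable_on_def)
  moreover have "e / 2 > 0"
    using \<open>e > 0\<close> by simp
  ultimately obtain S where S: "finite S" "S \<subseteq> I"
    and near: "\<And>G. finite G \<Longrightarrow> S \<subseteq> G \<Longrightarrow> G \<subseteq> I \<Longrightarrow> dist (sum \<psi> G) s < e / 2"
    by (rule has_sum_dist_less) (rule that)
  show thesis
  proof (rule that[OF S])
    fix G assume G: "finite G" "G \<subseteq> I - S"
    have "sum \<psi> (S \<union> G) = sum \<psi> S + sum \<psi> G"
      using G S by (intro sum.union_disjoint) auto
    moreover have "dist (sum \<psi> (S \<union> G)) s < e / 2" "dist (sum \<psi> S) s < e / 2"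
      using G S by (intro near; blast)+
    ultimately show "sum \<psi> G \<le> e"
      unfolding dist_real_def by linarith
  qed
qed

lemma norm_sum_mult_le_sqrt:
  fixes c \<phi> :: "'i \<Rightarrow> 'k::real_normed_field"
  assumes "(\<Sum>i\<in>G. (norm (c i))\<^sup>2) \<le> C" and "(\<Sum>i\<in>G. (norm (\<phi> i))\<^sup>2) \<le> e"
  shows "norm (\<Sum>i\<in>G. c i * \<phi> i) \<le> sqrt (C * e)"
proof -
  have "norm (\<Sum>i\<in>G. c i * \<phi> i) \<le> (\<Sum>i\<in>G. \<bar>norm (c i)\<bar> * \<bar>norm (\<phi> i)\<bar>)"
    using norm_sum[of "\<lambda>i. c i * \<phi> i" G] by (simp add: norm_mult)
  also have "\<dots> \<le> L2_set (\<lambda>i. norm (c i)) G * L2_set (\<lambda>i. norm (\<phi> i)) G"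
    by (rule L2_set_mult_ineq)
  also have "\<dots> \<le> sqrt C * sqrt e"
    \<comment> \<open>The second fact yields \<open>0 \<le> C\<close>, hence the nonnegativity of
      \<open>sqrt C\<close> that \<open>mult_mono\<close> asks for.\<close>
    using assms order_trans[OF sum_nonneg assms(1)]
    by (intro mult_mono) (auto simp: L2_set_def intro: sum_nonneg)
  finally show ?thesis
    by (simp add: real_sqrt_mult)
qed

text \<open>Dependent choice builds the chain. The requirement on the next set persists when that
  set grows inside \<open>I\<close>, so it is compatible with monotonicity and exhaustion.\<close>

lemma exhausting_finite_sets:
  fixes P :: "nat \<Rightarrow> 'i set \<Rightarrow> 'i set \<Rightarrow> bool"
  assumes "countable I"
    and ex: "\<And>k F. finite F \<Longrightarrow> F \<subseteq> I \<Longrightarrow>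
      \<exists>S. finite S \<and> S \<subseteq> I \<and> (\<forall>T. S \<subseteq> T \<longrightarrow> T \<subseteq> I \<longrightarrow> P k F T)"
  shows "\<exists>F. mono F \<and> (\<Union>k. F k) = I \<and> (\<forall>k. P k (F k) (F (Suc k)))"
proof -
  \<comment> \<open>Initial segments of an enumeration of \<open>I\<close>; placing
    \<open>E k\<close> inside stage \<open>Suc k\<close> makes the chain exhaust
    \<open>I\<close>.\<close>
  define E where "E k = {i \<in> I. to_nat_on I i \<le> k}" for k
  have finE: "finite (E k)" for k
  proof (rule inj_on_finite)
    show "inj_on (to_nat_on I) (E k)"
      by (rule inj_on_subset[OF inj_on_to_nat_on[OF assms(1)]]) (auto simp: E_def)
    show "to_nat_on I ` E k \<subseteq> {..k}"
      by (auto simp: E_def)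
  qed simp
  have step: "\<exists>T. (finite T \<and> T \<subseteq> I) \<and> F \<subseteq> T \<and> E k \<subseteq> T \<and> P k F T"
    if F: "finite F \<and> F \<subseteq> I" for F k
  proof -
    obtain S where S: "finite S" "S \<subseteq> I" "\<forall>T. S \<subseteq> T \<longrightarrow> T \<subseteq> I \<longrightarrow> P k F T"
      using ex[of F k] F by (elim exE conjE) auto
    have "E k \<subseteq> I" by (auto simp: E_def)
    then show ?thesis
      using S finE[of k] F by (intro exI[of _ "F \<union> E k \<union> S"]) (simp add: le_supI1)
  qed
  have "\<exists>F. \<forall>k. (finite (F k) \<and> F k \<subseteq> I) \<and>
      F k \<subseteq> F (Suc k) \<and> E k \<subseteq> F (Suc k) \<and> P k (F k) (F (Suc k))"
    by (rule dependent_nat_choice) (use step in auto)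
  then obtain F where F: "\<forall>k. (finite (F k) \<and> F k \<subseteq> I) \<and>
      F k \<subseteq> F (Suc k) \<and> E k \<subseteq> F (Suc k) \<and> P k (F k) (F (Suc k))"
    by (elim exE)
  have "I \<subseteq> (\<Union>k. F k)"
  proof
    fix i assume "i \<in> I"
    then have "i \<in> E (to_nat_on I i)" by (simp add: E_def)
    then show "i \<in> (\<Union>k. F k)" using F by blast
  qed
  moreover have "(\<Union>k. F k) \<subseteq> I" "mono F" "\<forall>k. P k (F k) (F (Suc k))"
    using F by (simp_all add: mono_iff_le_Suc UN_subset_iff)
  ultimately show ?thesis
    by (intro exI[of _ F]) simp
qed

text \<open>Conjugate symmetry enters only through absolute values, so that real and complex
  scalars are covered at once, without a conjugation on the scalars.\<close>

locale inner_product_module = module sc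
  for sc :: "'k::real_normed_field \<Rightarrow> 'h::real_normed_vector \<Rightarrow> 'h" +
  fixes ip :: "'h \<Rightarrow> 'h \<Rightarrow> 'k"
  assumes sc_of_real: "sc (of_real r) x = r *\<^sub>R x"
    and ip_add_left: "ip (x + y) z = ip x z + ip y z"
    and ip_sc_left: "ip (sc a x) y = a * ip x y"
    and ip_self: "ip x x = of_real ((norm x)\<^sup>2)"
    and norm_ip_commute: "norm (ip x y) = norm (ip y x)"
    and norm_ip_le: "norm (ip x y) \<le> norm x * norm y"
begin

section \<open>Linearity of the inner product and orthogonalisation\<close>

lemma bounded_linear_ip_left: "bounded_linear (\<lambda>x. ip x y)"
proof (rule bounded_linear_intro)
  fix r x
  show "ip (r *\<^sub>R x) y = r *\<^sub>R ip x y"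
    by (metis ip_sc_left sc_of_real scaleR_conv_of_real)
  show "norm (ip x y) \<le> norm x * norm y"
    by (rule norm_ip_le)
qed (rule ip_add_left)

lemmas linear_ip_left = bounded_linear.linear[OF bounded_linear_ip_left]

lemmas ip_diff_left = linear_diff[OF linear_ip_left]
  and ip_sum_left = linear_sum[OF linear_ip_left]

lemma ip_self_eq_0_iff: "ip x x = 0 \<longleftrightarrow> x = 0"
  by (simp add: ip_self)

lemma ip_eq_0_commute: "ip x y = 0 \<longleftrightarrow> ip y x = 0"
  by (metis norm_eq_zero norm_ip_commute)

lemma orthogonal_span:
  assumes "\<And>j. j \<in> F \<Longrightarrow> ip y (f j) = 0"
  shows "ip (\<Sum>j\<in>F. sc (d j) (f j)) y = 0"
proof -
  have "ip (f j) y = 0" if "j \<in> F" for j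
    using assms[OF that] ip_eq_0_commute by blast
  then show ?thesis
    by (simp add: ip_sum_left ip_sc_left)
qed

text \<open>Gram-Schmidt by induction on \<open>F\<close>, valid for dependent families too. The
  induction hypothesis serves both \<open>x\<close> and the new vector \<open>f k\<close>;
  subtracting a multiple of the residual \<open>r\<close> of \<open>f k\<close> from the residual
  \<open>u\<close> of \<open>x\<close> corrects the product with \<open>f k\<close> and keeps those
  over \<open>F\<close> zero.\<close>

lemma orthogonal_residual:
  assumes "finite F"
  shows "\<exists>c. \<forall>j\<in>F. ip (x - (\<Sum>i\<in>F. sc (c i) (f i))) (f j) = 0"
  using assms
proof (induction F arbitrary: x)
  case (insert k F)
  obtain c where c: "\<And>j. j \<in> F \<Longrightarrow> ip (x - (\<Sum>i\<in>F. sc (c i) (f i))) (f j) = 0"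
    using insert.IH by blast
  obtain d where d: "\<And>j. j \<in> F \<Longrightarrow> ip (f k - (\<Sum>i\<in>F. sc (d i) (f i))) (f j) = 0"
    using insert.IH by blast
  define u where "u = x - (\<Sum>i\<in>F. sc (c i) (f i))"
  define r where "r = f k - (\<Sum>i\<in>F. sc (d i) (f i))"
  \<comment> \<open>Solves \<open>ip (u - sc b r) (f k) = 0\<close>; when the denominator is 0,
    division returns 0.\<close>
  define b where "b = ip u (f k) / ip r (f k)"
  define c' where "c' i = (if i = k then b else c i - b * d i)" for i
  have "(\<Sum>i\<in>F. sc (c' i) (f i)) = (\<Sum>i\<in>F. sc (c i) (f i) - sc b (sc (d i) (f i)))"
    using insert.hyps by (intro sum.cong) (auto simp: c'_def scale_left_diff_distrib)
  also have "\<dots> = (\<Sum>i\<in>F. sc (c i) (f i)) - sc b (\<Sum>i\<in>F. sc (d i) (f i))"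
    by (simp add: sum_subtractf scale_sum_right del: scale_scale)
  finally have res: "x - (\<Sum>i\<in>insert k F. sc (c' i) (f i)) = u - sc b r"
    using insert.hyps by (simp add: u_def r_def c'_def scale_right_diff_distrib)
  have orth: "ip u (f j) = 0" "ip r (f j) = 0" if "j \<in> F" for j
    using c d that by (auto simp: u_def r_def)
  have fk: "f k = r + (\<Sum>i\<in>F. sc (d i) (f i))"
    by (simp add: r_def)
  have "ip u (f k) = b * ip r (f k)"
  proof (cases "ip r (f k) = 0")
    \<comment> \<open>Here \<open>r = 0\<close>, so \<open>f k\<close> is a combination of the
      vectors over \<open>F\<close>, and \<open>u\<close> is already orthogonal to it.\<close>
    case True
    then have "ip (f k) r = 0"
      using ip_eq_0_commute by blast
    then have "ip r r = 0"
      using orthogonal_span[of F r f d] orth(2) by (simp add: fk ip_add_left)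
    then have "f k = (\<Sum>i\<in>F. sc (d i) (f i))"
      by (simp add: fk ip_self_eq_0_iff)
    then have "ip (f k) u = 0"
      using orthogonal_span[of F u f d] orth(1) by simp
    then show ?thesis
      using True ip_eq_0_commute by auto
  qed (simp add: b_def)
  then have "\<forall>j\<in>insert k F. ip (u - sc b r) (f j) = 0"
    using orth by (simp add: ip_diff_left ip_sc_left)
  then show ?case
    unfolding res[symmetric] by blast
qed simp

text \<open>Take the component \<open>y\<close> of \<open>f i\<close> orthogonal to the other
  members of \<open>F\<close>. It is nonzero by independence, and \<open>ip (f i) y = ip y y\<close>
  because the subtracted combination is orthogonal to \<open>y\<close>.\<close>

lemma dual_vector:
  assumes "finite F" "i \<in> F" and indep: "finitely_independent sc F f"
  obtains y where "ip (f i) y \<noteq> 0" "\<And>j. j \<in> F - {i} \<Longrightarrow> ip (f j) y = 0"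
proof -
  obtain d where d: "\<And>j. j \<in> F - {i} \<Longrightarrow>
      ip (f i - (\<Sum>j\<in>F - {i}. sc (d j) (f j))) (f j) = 0"
    using orthogonal_residual[of "F - {i}" "f i" f] assms(1) by blast
  define y where "y = f i - (\<Sum>j\<in>F - {i}. sc (d j) (f j))"
  have orth: "ip y (f j) = 0" if "j \<in> F - {i}" for j
    using d[OF that] by (simp add: y_def)
  have "y \<noteq> 0"
  proof
    assume "y = 0"
    let ?d = "\<lambda>j. if j = i then 1 else - d j"
    have "(\<Sum>j\<in>F. sc (?d j) (f j)) = f i + (\<Sum>j\<in>F - {i}. sc (?d j) (f j))"
      using assms(1,2) by (subst sum.remove[of F i]) auto
    also have "(\<Sum>j\<in>F - {i}. sc (?d j) (f j)) = (\<Sum>j\<in>F - {i}. - sc (d j) (f j))"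
      by (rule sum.cong) auto
    also have "f i + \<dots> = y"
      by (simp add: y_def sum_negf)
    finally have "(\<Sum>j\<in>F. sc (?d j) (f j)) = 0"
      using \<open>y = 0\<close> by simp
    then have "\<forall>j\<in>F. ?d j = 0"
      using indep assms(1) unfolding finitely_independent_def
      by (elim allE[of _ F] impE allE[of _ ?d]) auto
    then have "?d i = 0"
      using assms(2) by (rule bspec)
    then show False by simp
  qed
  moreover have "ip y y = ip (f i) y"
    using orthogonal_span[of "F - {i}" y f d] orth by (subst y_def) (simp add: ip_diff_left)
  ultimately have "ip (f i) y \<noteq> 0"
    using ip_self_eq_0_iff by metis
  then show thesis
    using that orth ip_eq_0_commute by blast
qed

text \<open>The tail bound is relative to \<open>ip (f i) y\<close>, which avoids normalising
  \<open>y\<close>, and is stated over finite \<open>G\<close>, which avoids infinite sums.\<close>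

definition localized_dual ::
    "'i set \<Rightarrow> ('i \<Rightarrow> 'h) \<Rightarrow> real \<Rightarrow> 'i set \<Rightarrow> 'i set \<Rightarrow> 'i \<Rightarrow> 'h \<Rightarrow> bool"
  where "localized_dual I f e F T i y \<longleftrightarrow>
    ip (f i) y \<noteq> 0 \<and> (\<forall>j\<in>F - {i}. ip (f j) y = 0) \<and>
    (\<forall>G. finite G \<longrightarrow> G \<subseteq> I - T \<longrightarrow>
      (\<Sum>j\<in>G. (norm (ip (f j) y))\<^sup>2) \<le> e * (norm (ip (f i) y))\<^sup>2)"

lemma localized_dual_mono:
  assumes "localized_dual I f e F S i y" and "S \<subseteq> T"
  shows "localized_dual I f e F T i y"
proof -
  have "G \<subseteq> I - S" if "G \<subseteq> I - T" for G
    using that assms(2) by blast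
  then show ?thesis
    using assms(1) by (simp add: localized_dual_def)
qed

text \<open>The Bessel condition makes the coefficients of the dual vector square-summable, so their
  tail is small outside some finite \<open>S\<close>.\<close>

lemma localized_dual_exists:
  assumes bessel: "bessel_sequence ip I f" and indep: "finitely_independent sc I f"
    and F: "finite F" "F \<subseteq> I" "i \<in> F" and "e > 0"
  shows "\<exists>y S. finite S \<and> S \<subseteq> I \<and> localized_dual I f e F S i y"
proof -
  have "finitely_independent sc F f"
    using indep F(2) unfolding finitely_independent_def by blast
  then obtain y where y: "ip (f i) y \<noteq> 0" "\<And>j. j \<in> F - {i} \<Longrightarrow> ip (f j) y = 0"
    by (rule dual_vector[OF F(1,3)]) (rule that)
  have "(\<lambda>j. (norm (ip (f j) y))\<^sup>2) summable_on I"
    using bessel unfolding bessel_sequence_def by (auto simp: norm_ip_commute[of _ y])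
  moreover have "e * (norm (ip (f i) y))\<^sup>2 > 0"
    using y(1) \<open>e > 0\<close> by simp
  ultimately obtain S where "finite S" "S \<subseteq> I"
    "\<And>G. finite G \<Longrightarrow> G \<subseteq> I - S \<Longrightarrow>
      (\<Sum>j\<in>G. (norm (ip (f j) y))\<^sup>2) \<le> e * (norm (ip (f i) y))\<^sup>2"
    by (rule summable_on_small_tail) (rule that)
  then show ?thesis
    using y by (intro exI[of _ y] exI[of _ S]) (simp add: localized_dual_def)
qed

text \<open>At a gap \<open>k\<close>, the dual vector for \<open>i\<close> bounds
  \<open>norm (c i)\<close> by \<open>sqrt (C / Suc k)\<close>, with \<open>C\<close> the square sum
  of \<open>c\<close>; gaps occur arbitrarily late, so the bound tends to 0 along them.\<close>

lemma omega_independent_l2_if_gaps: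
  assumes "J \<subseteq> I" and "mono F" and "I \<subseteq> (\<Union>k. F k)"
    and dual: "\<And>k i. i \<in> F k \<Longrightarrow> \<exists>y. localized_dual I f (1 / Suc k) (F k) (F (Suc k)) i y"
    and gaps: "\<And>m. \<exists>k\<ge>m. J \<inter> (F (Suc k) - F k) = {}"
  shows "omega_independent_l2 sc J f"
  unfolding omega_independent_l2_def
proof (intro allI impI ballI, elim conjE)
  fix c i
  assume c2: "(\<lambda>j. (norm (c j))\<^sup>2) summable_on J"
    and c0: "((\<lambda>j. sc (c j) (f j)) has_sum 0) J" and "i \<in> J"
  define C where "C = (\<Sum>\<^sub>\<infinity>j\<in>J. (norm (c j))\<^sup>2)"
  have C: "(\<Sum>j\<in>G. (norm (c j))\<^sup>2) \<le> C" if "finite G" "G \<subseteq> J" for G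
    unfolding C_def using that c2 by (intro finite_sum_le_infsum) auto
  obtain k0 where "i \<in> F k0"
    using assms(1,3) \<open>i \<in> J\<close> by blast
  have bound: "norm (c i) \<le> sqrt (C * (1 / Suc k))"
    if "k \<ge> k0" and gap: "J \<inter> (F (Suc k) - F k) = {}" for k
  proof -
    have "i \<in> F k"
      using \<open>i \<in> F k0\<close> monoD[OF \<open>mono F\<close> \<open>k \<ge> k0\<close>] by blast
    then obtain y where y: "localized_dual I f (1 / Suc k) (F k) (F (Suc k)) i y"
      using dual by blast
    have y1: "ip (f i) y \<noteq> 0" and y0: "\<And>j. j \<in> F k - {i} \<Longrightarrow> ip (f j) y = 0"
      and small: "\<And>G. finite G \<Longrightarrow> G \<subseteq> I - F (Suc k) \<Longrightarrow>
        (\<Sum>j\<in>G. (norm (ip (f j) y))\<^sup>2) \<le> 1 / Suc k * (norm (ip (f i) y))\<^sup>2"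
      using y by (simp_all add: localized_dual_def)
    have total: "((\<lambda>j. c j * ip (f j) y) has_sum 0) J"
      using has_sum_bounded_linear[OF bounded_linear_ip_left[of y] c0]
      by (simp add: o_def ip_sc_left linear_0[OF linear_ip_left])
    \<comment> \<open>The slack \<open>e\<close> allows a finite partial sum in place of the total
      0, and is removed afterwards.\<close>
    have "norm (c i) * norm (ip (f i) y) \<le> norm (ip (f i) y) * sqrt (C * (1 / Suc k)) + e"
      if "e > 0" for e
    proof -
      obtain H where "finite H" "H \<subseteq> J" and
        H: "\<And>G. finite G \<Longrightarrow> H \<subseteq> G \<Longrightarrow> G \<subseteq> J \<Longrightarrow> dist (\<Sum>j\<in>G. c j * ip (f j) y) 0 < e"
        using has_sum_dist_less[OF total \<open>e > 0\<close>] by metis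
      define G where "G = insert i H"
      have G: "finite G" "G \<subseteq> J" "H \<subseteq> G"
        using \<open>finite H\<close> \<open>H \<subseteq> J\<close> \<open>i \<in> J\<close> by (auto simp: G_def)
      \<comment> \<open>Indices of \<open>F k\<close> other than \<open>i\<close> contribute
        nothing, by orthogonality to \<open>y\<close>.\<close>
      have "(\<Sum>j\<in>G. c j * ip (f j) y) = (\<Sum>j\<in>insert i (G - F k). c j * ip (f j) y)"
        using G(1) y0 by (intro sum.mono_neutral_right) (auto simp: G_def)
      also have "\<dots> = c i * ip (f i) y + (\<Sum>j\<in>G - F k. c j * ip (f j) y)"
        using G(1) \<open>i \<in> F k\<close> by simp
      finally have "c i * ip (f i) y = (\<Sum>j\<in>G. c j * ip (f j) y) - (\<Sum>j\<in>G - F k. c j * ip (f j) y)"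
        by simp
      then have "norm (c i * ip (f i) y) \<le> norm (\<Sum>j\<in>G. c j * ip (f j) y) +
          norm (\<Sum>j\<in>G - F k. c j * ip (f j) y)"
        by (metis norm_triangle_ineq4)
      moreover have "norm (\<Sum>j\<in>G. c j * ip (f j) y) < e"
        using H[of G] G by simp
      \<comment> \<open>By the gap, \<open>G - F k\<close> avoids all of \<open>F (Suc k)\<close>,
        so the tail bound applies.\<close>
      moreover have "norm (\<Sum>j\<in>G - F k. c j * ip (f j) y) \<le> sqrt (C * (1 / Suc k * (norm (ip (f i) y))\<^sup>2))"
        using G gap assms(1) by (intro norm_sum_mult_le_sqrt C small) auto
      ultimately show ?thesis
        by (simp add: norm_mult real_sqrt_mult real_sqrt_divide mult.commute)
    qed
    then have "norm (c i) * norm (ip (f i) y) \<le> norm (ip (f i) y) * sqrt (C * (1 / Suc k))"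
      by (rule field_le_epsilon)
    then show ?thesis
      using y1 by (simp add: mult.commute)
  qed
  have "norm (c i) \<le> 0 + e" if "e > 0" for e :: real
  proof -
    have "(\<lambda>k. sqrt (C * (1 / real (Suc k)))) \<longlonglongrightarrow> sqrt (C * 0)"
      using LIMSEQ_inverse_real_of_nat
      by (intro tendsto_intros) (simp add: inverse_eq_divide)
    then have "\<forall>\<^sub>F k in sequentially. sqrt (C * (1 / real (Suc k))) < e"
      using that by (intro order_tendstoD(2)) auto
    then obtain m where m: "\<And>k. k \<ge> m \<Longrightarrow> sqrt (C * (1 / real (Suc k))) < e"
      unfolding eventually_sequentially by blast
    obtain k where "k \<ge> max k0 m" "J \<inter> (F (Suc k) - F k) = {}"
      using gaps by blast
    then show ?thesis
      using bound[of k] m[of k] by simp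
  qed
  then have "norm (c i) \<le> 0"
    by (rule field_le_epsilon)
  then show "c i = 0" by simp
qed

theorem partition_omega_independent_l2:
  assumes "countable I" and bessel: "bessel_sequence ip I f"
    and indep: "finitely_independent sc I f"
  obtains I1 I2 where "I1 \<union> I2 = I" "I1 \<inter> I2 = {}"
    "omega_independent_l2 sc I1 f" "omega_independent_l2 sc I2 f"
proof -
  define P where "P k F T \<longleftrightarrow> (\<forall>i\<in>F. \<exists>y. localized_dual I f (1 / Suc k) F T i y)"
    for k F T
  have ex: "\<exists>S. finite S \<and> S \<subseteq> I \<and> (\<forall>T. S \<subseteq> T \<longrightarrow> T \<subseteq> I \<longrightarrow> P k F T)"
    if F: "finite F" "F \<subseteq> I" for k F
  proof -
    have "\<exists>y S. finite S \<and> S \<subseteq> I \<and> localized_dual I f (1 / Suc k) F S i y" if "i \<in> F" for i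
      using localized_dual_exists[OF bessel indep F that] by simp
    then obtain y S where yS: "\<And>i. i \<in> F \<Longrightarrow>
        finite (S i) \<and> S i \<subseteq> I \<and> localized_dual I f (1 / Suc k) F (S i) i (y i)"
      by metis
    \<comment> \<open>One finite set serves every \<open>i\<close> in \<open>F\<close>: the union of
      the finitely many \<open>S i\<close>, by monotonicity in the outer set.\<close>
    have "P k F T" if "(\<Union>i\<in>F. S i) \<subseteq> T" for T
      unfolding P_def using yS that by (meson UN_subset_iff localized_dual_mono)
    then show ?thesis
      using F(1) yS by (intro exI[of _ "\<Union>i\<in>F. S i"]) auto
  qed
  have "\<exists>F. mono F \<and> (\<Union>k. F k) = I \<and> (\<forall>k. P k (F k) (F (Suc k)))"
    using assms(1) ex by (rule exhausting_finite_sets)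
  then obtain F where "mono F" and UF: "(\<Union>k. F k) = I" and PF: "\<forall>k. P k (F k) (F (Suc k))"
    by (elim exE conjE)
  \<comment> \<open>The first stage containing \<open>i\<close>: 0 on \<open>F 0\<close>, and
    \<open>Suc k\<close> on the layer \<open>F (Suc k) - F k\<close>.\<close>
  define level where "level i = (LEAST k. i \<in> F k)" for i
  have level: "level i = Suc k" if "i \<in> F (Suc k) - F k" for i k
    unfolding level_def
  proof (rule Least_equality)
    fix m assume "i \<in> F m"
    then show "Suc k \<le> m"
      using that monoD[OF \<open>mono F\<close>, of m k] not_less_eq_eq by blast
  qed (use that in simp)
  have indep_part: "omega_independent_l2 sc {i \<in> I. even (level i) = b} f" for b
  proof (rule omega_independent_l2_if_gaps[OF _ \<open>mono F\<close>])
    show "\<exists>k\<ge>m. {i \<in> I. even (level i) = b} \<inter> (F (Suc k) - F k) = {}" for m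
      \<comment> \<open>Because of the shift by one, the part of even level misses the layers with
        \<open>k\<close> even, and the part of odd level those with \<open>k\<close> odd.\<close>
      by (intro exI[of _ "2 * m + (if b then 0 else 1)"]) (auto dest!: level)
    show "\<exists>y. localized_dual I f (1 / Suc k) (F k) (F (Suc k)) i y" if "i \<in> F k" for k i
      using PF that by (simp add: P_def)
  qed (use UF in auto)
  show thesis
    by (rule that[OF _ _ indep_part[of True] indep_part[of False]]) auto
qed

end

section \<open>Norm and Cauchy-Schwarz for complex inner products\<close>

lemma norm_scaleC: "norm (scaleC a x) = norm a * norm x"
proof -
  have "complex_of_real ((norm (scaleC a x))\<^sup>2) = a * cnj a * cinner x x"
    \<comment> \<open>Conjugate symmetry turns the factor in the second argument into
      \<open>cnj a\<close>; the last instance makes \<open>cinner x x\<close> its own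
      conjugate.\<close>
    using cinner_self[of "scaleC a x"] cinner_commute[of x "scaleC a x"] cinner_commute[of x x]
    by (simp add: cinner_scaleC_left mult.assoc)
  also have "\<dots> = complex_of_real ((norm a * norm x)\<^sup>2)"
    by (simp add: cinner_self power_mult_distrib flip: complex_norm_square)
  finally have "(norm (scaleC a x))\<^sup>2 = (norm a * norm x)\<^sup>2"
    using of_real_eq_iff by blast
  then show ?thesis
    by (simp add: power2_eq_iff_nonneg)
qed

text \<open>The class comes with a norm, so this follows from the triangle inequality by expanding
  the square of \<open>norm (x + y)\<close>.\<close>

lemma Re_cinner_le: "Re (cinner x y) \<le> norm x * norm y"
proof -
  have "cinner (x + y) (x + y) = cinner x x + cinner y y + (cinner x y + cnj (cinner x y))"
    using cinner_commute[of x "x + y"] cinner_commute[of y "x + y"] cinner_commute[of y x]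
      cinner_commute[of x x] cinner_commute[of y y]
    by (simp add: cinner_add_left)
  then have "complex_of_real ((norm (x + y))\<^sup>2) =
      complex_of_real ((norm x)\<^sup>2 + (norm y)\<^sup>2 + 2 * Re (cinner x y))"
    by (simp add: cinner_self complex_add_cnj)
  then have "(norm (x + y))\<^sup>2 = (norm x)\<^sup>2 + (norm y)\<^sup>2 + 2 * Re (cinner x y)"
    using of_real_eq_iff by blast
  moreover have "(norm (x + y))\<^sup>2 \<le> (norm x + norm y)\<^sup>2"
    by (intro power_mono norm_triangle_ineq norm_ge_zero)
  ultimately show ?thesis
    by (simp add: power2_sum)
qed

text \<open>Rotating \<open>x\<close> by a scalar of modulus 1 makes the inner product real and
  nonnegative, which reduces the claim to the bound on real parts.\<close>

lemma norm_cinner_le: "norm (cinner x y) \<le> norm x * norm y"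
proof (cases "cinner x y = 0")
  case False
  define a where "a = cnj (cinner x y) / norm (cinner x y)"
  have "norm a = 1"
    using False by (simp add: a_def norm_divide)
  have "a * cinner x y = norm (cinner x y)"
    using False complex_norm_square[of "cinner x y"]
    by (simp add: a_def field_simps power2_eq_square)
  then have "norm (cinner x y) = Re (cinner (scaleC a x) y)"
    by (simp add: cinner_scaleC_left)
  also have "\<dots> \<le> norm (scaleC a x) * norm y"
    by (rule Re_cinner_le)
  finally show ?thesis
    using \<open>norm a = 1\<close> by (simp add: norm_scaleC)
qed simp

section \<open>Real and complex scalars as instances\<close>

interpretation real: inner_product_module scaleR inner
  by standard
    (auto simp: inner_add_left inner_commute power2_norm_eq_inner Cauchy_Schwarz_ineq2
      algebra_simps)

lemma scaleC_one: "scaleC 1 x = x"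
  using scaleC_of_real[of 1 x] by simp

interpretation complex: inner_product_module scaleC cinner
proof
  show "norm (cinner x y) = norm (cinner y x)" for x y :: 'a
    using cinner_commute[of x y] by simp
qed (auto simp: scaleC_add_right scaleC_add_left scaleC_scaleC scaleC_one scaleC_of_real
    cinner_add_left cinner_scaleC_left cinner_self norm_cinner_le)

theorem theorem1p4:
  fixes I :: "'i set"
    and f :: "'i \<Rightarrow> 'h::{real_inner, complete_space}"
    and g :: "'i \<Rightarrow> 'g::{complex_inner, complete_space}"
  assumes "countable I"
  shows
    "(separable_space (euclidean :: 'h topology) \<and>
      bessel_sequence inner I f \<and> unit_norm I f \<and> finitely_independent scaleR I f \<longrightarrow>
      (\<exists>I1 I2. I1 \<union> I2 = I \<and> I1 \<inter> I2 = {} \<and>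
        omega_independent_l2 scaleR I1 f \<and> omega_independent_l2 scaleR I2 f)) \<and>
     (separable_space (euclidean :: 'g topology) \<and>
      bessel_sequence cinner I g \<and> unit_norm I g \<and> finitely_independent scaleC I g \<longrightarrow>
      (\<exists>I1 I2. I1 \<union> I2 = I \<and> I1 \<inter> I2 = {} \<and>
        omega_independent_l2 scaleC I1 g \<and> omega_independent_l2 scaleC I2 g))"
  using real.partition_omega_independent_l2[OF assms, of f]
    complex.partition_omega_independent_l2[OF assms, of g]
  by metis

end
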